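(* Let $q$ be a prime power and let $1\leq m\leq n/2$. The sets $$T_q(n,m)\times\prod_{X\in B_q(n)_{m-1}}\mathcal{DU}(X)\qquad\text{and}\qquad T_q(n,m-1)\times\prod_{X\in B_q(n)_m}\mathcal{UD}(X)$$ have the same cardinality.
   Context: $B_q(n)_k$ is the set of $k$-dimensional subspaces of $\mathbb{F}_q^n$. For $0\leq m\leq n/2$, the Grassmann graph $C_q(n,m)$ has vertex set $B_q(n)_m$, with $X,Y$ adjacent iff $\dim(X\cap Y)=m-1$. A rooted spanning tree of a graph is a spanning tree together with a choice of a vertex as root; $T_q(n,m)$ is the set of rooted spanning trees of $C_q(n,m)$. For $1\leq k\leq n$, $X\in B_q(n)_k$ and $X'\in B_q(n)_{k-1}$: $\mathcal{UD}(X)=\{(Y,Z)\in B_q(n)_{k-1}\times B_q(n)_k : X\supseteq Y\subseteq Z\}$ and $\mathcal{DU}(X')=\{(Y',Z')\in B_q(n)_k\times B_q(n)_{k-1}: X'\subseteq Y'\supseteq Z'\}$. The products are Cartesian products. *)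

theory Defs
  imports
    "HOL-Analysis.Cartesian_Space"
    "HOL-Library.FuncSet"
    "HOL-Library.Equipollence"
begin

text \<open>
  A finite undirected simple graph is given by its vertex set \<open>V\<close> and a set \<open>E\<close> of two-element
  subsets of \<open>V\<close>.
\<close>

definition connected_graph :: "'v set \<Rightarrow> 'v set set \<Rightarrow> bool" where
  "connected_graph V E \<longleftrightarrow> (\<forall>u\<in>V. \<forall>v\<in>V. (u, v) \<in> {(x, y). {x, y} \<in> E}\<^sup>*)"

definition is_cycle :: "'v set set \<Rightarrow> 'v list \<Rightarrow> bool" where
  "is_cycle E c \<longleftrightarrow> length c \<ge> 3 \<and> distinct c \<and>
     (\<forall>i < length c. {c ! i, c ! (Suc i mod length c)} \<in> E)"

definition is_tree :: "'v set \<Rightarrow> 'v set set \<Rightarrow> bool" where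
  "is_tree V E \<longleftrightarrow> V \<noteq> {} \<and> connected_graph V E \<and> (\<nexists>c. is_cycle E c)"

text \<open>A spanning tree of \<open>(V, E)\<close> has vertex set \<open>V\<close>, so it is represented by its edge set alone.\<close>

definition spanning_trees :: "'v set \<Rightarrow> 'v set set \<Rightarrow> 'v set set set" where
  "spanning_trees V E = {F. F \<subseteq> E \<and> is_tree V F}"

definition rooted_spanning_trees :: "'v set \<Rightarrow> 'v set set \<Rightarrow> ('v set set \<times> 'v) set" where
  "rooted_spanning_trees V E = spanning_trees V E \<times> V"

text \<open>
  Below, \<open>'a\<close> ranges over the finite fields, with \<open>q = CARD('a)\<close>, and \<open>n = CARD('n)\<close>.
\<close>

definition Bq :: "nat \<Rightarrow> ('a::{field,finite} ^ 'n::finite) set set" where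
  "Bq k = {X. vec.subspace X \<and> vec.dim X = k}"

text \<open>
  The condition \<open>dim (X \<inter> Y) = m - 1\<close> is stated without truncated subtraction, so that for
  \<open>m = 0\<close> there is no edge (in particular no loop) at the zero subspace.
\<close>

definition grassmann_edges :: "nat \<Rightarrow> ('a::{field,finite} ^ 'n::finite) set set set" where
  "grassmann_edges m = {{X, Y} | X Y. X \<in> Bq m \<and> Y \<in> Bq m \<and> vec.dim (X \<inter> Y) + 1 = m}"

definition Tq ::
  "nat \<Rightarrow> (('a::{field,finite} ^ 'n::finite) set set set \<times> ('a ^ 'n) set) set" where
  "Tq m = rooted_spanning_trees (Bq m) (grassmann_edges m)"

text \<open>
  In the next two definitions \<open>1 \<le> k\<close> is intended, with \<open>X\<close> of dimension \<open>k\<close> in \<open>UD k X\<close>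
  and of dimension \<open>k - 1\<close> in \<open>DU k X\<close>.
\<close>

definition UD :: "nat \<Rightarrow> ('a::{field,finite} ^ 'n::finite) set
    \<Rightarrow> (('a ^ 'n) set \<times> ('a ^ 'n) set) set" where
  "UD k X = {(Y, Z). Y \<in> Bq (k - 1) \<and> Z \<in> Bq k \<and> Y \<subseteq> X \<and> Y \<subseteq> Z}"

definition DU :: "nat \<Rightarrow> ('a::{field,finite} ^ 'n::finite) set
    \<Rightarrow> (('a ^ 'n) set \<times> ('a ^ 'n) set) set" where
  "DU k X = {(Y, Z). Y \<in> Bq k \<and> Z \<in> Bq (k - 1) \<and> X \<subseteq> Y \<and> Z \<subseteq> Y}"

end

theory Submission
  imports Defs "HOL-Analysis.Determinants"
begin

text \<open>
  Let \<open>V\<close> and \<open>W\<close> be the sets of subspaces of dimension \<open>m\<close> and \<open>m - 1\<close>, let \<open>N\<close> be their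
  incidence matrix and let \<open>c\<close> be the common size of the sets \<open>UD X\<close> and \<open>DU X\<close>. Since two distinct
  vertices of either Grassmann graph are adjacent iff they have exactly one common neighbour in the
  incidence relation, and otherwise have none, \<open>c - N\<^sup>T N\<close> and \<open>c - N N\<^sup>T\<close> are the Laplacians of the
  two graphs. By the matrix forest theorem, \<open>det (t + c - N\<^sup>T N)\<close> enumerates the rooted spanning
  forests of the graph on \<open>V\<close> by their number of roots, and likewise for \<open>W\<close>. Up to a power of
  \<open>t + c\<close> the two determinants agree, and comparing the coefficients of \<open>t\<close> yields
  \<open>T(V) c^|W| = T(W) c^|V|\<close> for the numbers \<open>T\<close> of rooted spanning trees.
\<close>

section \<open>Determinants as sums over rooted forests\<close>

text \<open>A map \<open>f\<close> encodes a rooted forest: \<open>f i\<close> is the parent of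
  \<open>i\<close>, and the fixed points are the roots. Acyclicity then means that iteration from
  every point ends in a fixed point.\<close>

inductive reaches_root :: "('v \<Rightarrow> 'v) \<Rightarrow> 'v \<Rightarrow> bool" for f :: "'v \<Rightarrow> 'v" where
  root: "f i = i \<Longrightarrow> reaches_root f i"
| step: "reaches_root f (f i) \<Longrightarrow> reaches_root f i"

definition forest_map :: "('v \<Rightarrow> 'v) \<Rightarrow> bool" where
  "forest_map f \<longleftrightarrow> (\<forall>i. reaches_root f i)"

lemma reaches_root_image_iff: "reaches_root f (f i) \<longleftrightarrow> reaches_root f i"
  by (metis reaches_root.cases reaches_root.step)

lemma forest_map_fun_upd_self:
  assumes "forest_map f"
  shows "forest_map (f(i := i))"
proof -
  have "reaches_root (f(i := i)) j" if "reaches_root f j" for j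
    using that
  proof (induction rule: reaches_root.induct)
    case (root j)
    then show ?case by (intro reaches_root.root) auto
  next
    case (step j)
    then show ?case
      by (cases "j = i") (auto intro: reaches_root.intros)
  qed
  with assms show ?thesis by (simp add: forest_map_def)
qed

text \<open>This is \<open>I - P\<close>, where \<open>P\<close> has a 1 at position
  \<open>(i, f i)\<close> for every non-root \<open>i\<close>. Such matrices are the terms of the
  multilinear expansion in \<open>weighted_matrix_forest\<close>.\<close>

definition parent_matrix :: "('v \<Rightarrow> 'v) \<Rightarrow> real ^ 'v ^ 'v::finite" where
  "parent_matrix f = (\<chi> i. if f i = i then axis i 1 else axis i 1 - axis (f i) 1)"

text \<open>Adding the row of a root to the row of one of its children turns the child into a root
  and keeps the determinant. By induction on the number of non-roots this ends at the identity
  matrix.\<close>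

lemma det_parent_matrix_forest:
  fixes f :: "'v::finite \<Rightarrow> 'v"
  assumes "forest_map f"
  shows "det (parent_matrix f) = 1"
  using assms
proof (induction "card {i. f i \<noteq> i}" arbitrary: f rule: less_induct)
  case less
  show ?case
  proof (cases "\<exists>i. f i \<noteq> i")
    case False
    then have "parent_matrix f = mat 1"
      by (auto simp: parent_matrix_def mat_def vec_eq_iff axis_def)
    then show ?thesis by simp
  next
    case True
    then obtain i0 where i0: "f i0 \<noteq> i0" by blast
    \<comment> \<open>The last non-root on the way from \<open>i0\<close> to its root has a root as
      its parent.\<close>
    have "reaches_root f i0" using less.prems by (simp add: forest_map_def)
    from this i0 have "\<exists>i. f i \<noteq> i \<and> f (f i) = f i"
      by (induction rule: reaches_root.induct) auto
    then obtain i where i: "f i \<noteq> i" "f (f i) = f i" by blast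
    let ?g = "f(i := i)"
    have "{j. ?g j \<noteq> j} = {j. f j \<noteq> j} - {i}" by auto
    then have "card {j. ?g j \<noteq> j} < card {j. f j \<noteq> j}"
      using i(1) card_Diff1_less[of "{j. f j \<noteq> j}" i] by simp
    then have "det (parent_matrix ?g) = 1"
      using less.hyps forest_map_fun_upd_self[OF less.prems] by blast
    moreover have "parent_matrix ?g = (\<chi> k. if k = i then row i (parent_matrix f)
        + 1 *s row (f i) (parent_matrix f) else row k (parent_matrix f))"
      using i by (simp add: parent_matrix_def row_def vec_eq_iff)
    ultimately show ?thesis
      using det_row_operation[of i "f i" "parent_matrix f" 1] i(1) by simp
  qed
qed

text \<open>The indicator of the points that never reach a root lies in the kernel.\<close>

lemma det_parent_matrix_not_forest:
  fixes f :: "'v::finite \<Rightarrow> 'v"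
  assumes "\<not> forest_map f"
  shows "det (parent_matrix f) = 0"
proof -
  define x :: "real ^ 'v" where "x = (\<chi> j. if reaches_root f j then 0 else 1)"
  have "(parent_matrix f *v x) $ i = 0" for i
  proof (cases "f i = i")
    case True
    then have "(parent_matrix f *v x) $ i = x $ i"
      by (simp add: matrix_vector_mult_def parent_matrix_def axis_def if_distrib[of "\<lambda>a. a * _"]
          cong: if_cong)
    also have "\<dots> = 0" using True by (simp add: x_def reaches_root.root)
    finally show ?thesis .
  next
    case False
    then have "(parent_matrix f *v x) $ i = (\<Sum>j\<in>UNIV. axis i 1 $ j * x $ j - axis (f i) 1 $ j * x $ j)"
      by (simp add: matrix_vector_mult_def parent_matrix_def algebra_simps)
    also have "\<dots> = x $ i - x $ f i"
      by (simp add: sum_subtractf axis_def if_distrib[of "\<lambda>a. a * _"] cong: if_cong)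
    also have "\<dots> = 0"
      by (simp add: x_def reaches_root_image_iff)
    finally show ?thesis .
  qed
  then have "parent_matrix f *v x = 0" by (simp add: vec_eq_iff)
  moreover have "x \<noteq> 0"
    using assms by (auto simp: x_def vec_eq_iff forest_map_def)
  ultimately show ?thesis
    using matrix_left_invertible_ker[of "parent_matrix f"]
    by (metis invertible_det_nz invertible_left_inverse)
qed

text \<open>Row \<open>i\<close> is a sum over \<open>k\<close> of the contribution of choosing
  \<open>k\<close> as the parent of \<open>i\<close>, where \<open>k = i\<close> makes
  \<open>i\<close> a root. Multilinearity expands the determinant over all choice functions
  \<open>f\<close>; each term is its weight times \<open>det (parent_matrix f)\<close>, which is 1
  for forests and 0 otherwise.\<close>

theorem weighted_matrix_forest:
  fixes s :: "'v::finite \<Rightarrow> real" and w :: "'v \<Rightarrow> 'v \<Rightarrow> real"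
  shows "det (\<chi> i j. if i = j then s i + (\<Sum>k\<in>UNIV - {i}. w i k) else - w i j) =
    (\<Sum>f | forest_map f. \<Prod>i\<in>UNIV. if f i = i then s i else w i (f i))"
proof -
  define c where "c i k = (if k = i then s i else w i k)" for i k
  define a :: "'v \<Rightarrow> 'v \<Rightarrow> real ^ 'v"
    where "a i k = c i k *s (if k = i then axis i 1 else axis i 1 - axis k 1)" for i k
  have row: "(\<chi> j. if i = j then s i + (\<Sum>k\<in>UNIV - {i}. w i k) else - w i j) = sum (a i) UNIV" for i
  proof -
    have "sum (a i) UNIV $ j = (if i = j then s i + (\<Sum>k\<in>UNIV - {i}. w i k) else - w i j)" for j
    proof -
      have "sum (a i) UNIV $ j = a i i $ j + (\<Sum>k\<in>UNIV - {i}. a i k $ j)"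
        by (simp add: sum.remove[of _ i])
      also have "(\<Sum>k\<in>UNIV - {i}. a i k $ j)
          = (\<Sum>k\<in>UNIV - {i}. (if i = j then w i k else 0) - (if k = j then w i k else 0))"
        by (rule sum.cong) (auto simp: a_def c_def axis_def)
      also have "\<dots> = (if i = j then \<Sum>k\<in>UNIV - {i}. w i k else 0) - (if i = j then 0 else w i j)"
        by (simp add: sum_subtractf)
      finally show ?thesis by (simp add: a_def c_def axis_def)
    qed
    then show ?thesis by (simp add: vec_eq_iff)
  qed
  have "det (\<chi> i j. if i = j then s i + (\<Sum>k\<in>UNIV - {i}. w i k) else - w i j)
      = det (\<chi> i. sum (a i) UNIV)"
    by (simp add: row)
  also have "\<dots> = (\<Sum>f\<in>UNIV. det (\<chi> i. a i (f i)))"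
    by (simp add: det_linear_rows_sum)
  also have "\<dots> = (\<Sum>f\<in>UNIV. (\<Prod>i\<in>UNIV. c i (f i)) * det (parent_matrix f))"
    by (simp add: a_def det_rows_mul parent_matrix_def)
  also have "\<dots> = (\<Sum>f\<in>UNIV. if forest_map f then \<Prod>i\<in>UNIV. c i (f i) else 0)"
    by (rule sum.cong) (auto simp: det_parent_matrix_forest det_parent_matrix_not_forest)
  also have "\<dots> = (\<Sum>f | forest_map f. \<Prod>i\<in>UNIV. c i (f i))"
    by (simp add: sum.If_cases)
  finally show ?thesis by (simp add: c_def)
qed

text \<open>With \<open>x = y\<^sup>2\<close>, both sides multiplied by \<open>det (y I)\<close> equal
  \<open>det (y I - A) det (y I + A + B) det (y I - B)\<close>.\<close>

lemma det_diff_mult_commute: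
  fixes A B :: "real ^ 'v ^ 'v::finite"
  assumes "A ** A = 0" and "B ** B = 0" and "x > 0"
  shows "det (mat x - A ** B) = det (mat x - B ** A)"
proof -
  define y where "y = sqrt x"
  have y: "y \<noteq> 0" "y * y = x" using \<open>x > 0\<close> by (simp_all add: y_def)
  let ?Y = "mat y :: real ^ 'v ^ 'v"
  have key: "det (?Y - C) * (det (?Y + C + D) * det (?Y - D)) = det ?Y * det (mat x - C ** D)"
    if "C ** C = 0" "D ** D = 0" for C D :: "real ^ 'v ^ 'v"
  proof -
    have scale [simp]: "mat a ** M = a *\<^sub>R M" "M ** mat a = a *\<^sub>R M" for a and M :: "real ^ 'v ^ 'v"
      by (simp_all add: vec_eq_iff matrix_matrix_mult_def mat_def if_distrib if_distribR cong: if_cong)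
    have mat_eq: "a *\<^sub>R (mat b :: real ^ 'v ^ 'v) = mat (a * b)" for a b
      by (simp add: vec_eq_iff mat_def)
    have sub: "(P - Q) ** R = P ** R - Q ** R" "P ** (Q - R) = P ** Q - P ** R"
      and add: "(P + Q) ** R = P ** R + Q ** R"
      and scaleR: "(a *\<^sub>R P) ** R = a *\<^sub>R (P ** R)" "P ** (a *\<^sub>R R) = a *\<^sub>R (P ** R)"
      for P Q R :: "real ^ 'v ^ 'v" and a
      by (simp_all add: vec_eq_iff matrix_matrix_mult_def algebra_simps sum_subtractf sum.distrib
          sum_distrib_left)
    \<comment> \<open>All terms linear in \<open>C\<close> or \<open>D\<close> cancel, and those
      containing \<open>C ** C\<close> or \<open>D ** D\<close> vanish.\<close>
    have "(?Y - C) ** ((?Y + C + D) ** (?Y - D)) = ?Y ** (mat x - C ** D)"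
    proof -
      have 1: "(?Y + C + D) ** (?Y - D) = mat x + y *\<^sub>R C - C ** D"
        using that y(2) by (simp add: sub add mat_eq scaleR_add_right)
      have 2: "C ** (C ** D) = 0"
        using that by (simp add: matrix_mul_assoc)
      show ?thesis
        unfolding 1 using that y(2)
        by (simp add: sub matrix_add_ldistrib scaleR 2 scaleR_diff_right scaleR_add_right mat_eq mult_ac)
    qed
    from arg_cong[OF this, of det] show ?thesis by (simp only: det_mul)
  qed
  have "det ?Y \<noteq> 0"
    using y(1) by (subst det_diagonal) (auto simp: mat_def)
  moreover have "det ?Y * det (mat x - A ** B) = det ?Y * det (mat x - B ** A)"
  proof -
    have "?Y + B + A = ?Y + A + B" by (simp add: add_ac)
    then show ?thesis
      unfolding key[OF assms(1,2), symmetric] key[OF assms(2,1), symmetric] by (simp only: mult_ac)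
  qed
  ultimately show ?thesis by (metis mult_left_cancel)
qed

section \<open>Forest maps and rooted spanning trees\<close>

text \<open>The depth of \<open>i\<close> in the forest, meaningful only if \<open>i\<close> reaches
  a root. It grows by one from parent to child, which serves to rule out cycles.\<close>

definition root_distance :: "('v \<Rightarrow> 'v) \<Rightarrow> 'v \<Rightarrow> nat" where
  "root_distance f i = (LEAST k. f ((f ^^ k) i) = (f ^^ k) i)"

lemma root_distance_Suc:
  assumes "reaches_root f i" and "f i \<noteq> i"
  shows "root_distance f i = Suc (root_distance f (f i))"
proof -
  have "\<exists>k. f ((f ^^ k) i) = (f ^^ k) i"
    using assms(1)
  proof (induction rule: reaches_root.induct)
    case (root i)
    then have "f ((f ^^ 0) i) = (f ^^ 0) i" by simp
    then show ?case by blast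
  next
    case (step i)
    then obtain k where "f ((f ^^ k) (f i)) = (f ^^ k) (f i)" by blast
    then have "f ((f ^^ Suc k) i) = (f ^^ Suc k) i" by (simp add: funpow_swap1)
    then show ?case by blast
  qed
  then obtain k where "f ((f ^^ k) i) = (f ^^ k) i" by blast
  from Least_Suc[of "\<lambda>k. f ((f ^^ k) i) = (f ^^ k) i", OF this] assms(2)
  show ?thesis by (simp add: root_distance_def funpow_swap1)
qed

definition parent_edges :: "('v \<Rightarrow> 'v) \<Rightarrow> 'v set set" where
  "parent_edges f = {{i, f i} | i. f i \<noteq> i}"

lemma parent_edges_iff:
  "{u, v} \<in> parent_edges f \<longleftrightarrow> u \<noteq> v \<and> (f u = v \<or> f v = u)"
  by (auto simp: parent_edges_def doubleton_eq_iff)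

text \<open>At a vertex of maximal depth on a cycle, both neighbours would have to be its parent,
  although they are distinct.\<close>

lemma not_is_cycle_parent_edges:
  assumes "forest_map f"
  shows "\<not> is_cycle (parent_edges f) c"
proof
  assume c: "is_cycle (parent_edges f) c"
  let ?n = "length c"
  have n: "?n \<ge> 3" and dist: "distinct c"
    and e: "\<And>i. i < ?n \<Longrightarrow> {c ! i, c ! (Suc i mod ?n)} \<in> parent_edges f"
    using c by (auto simp: is_cycle_def)
  have "finite (root_distance f ` set c)" "root_distance f ` set c \<noteq> {}" using n by auto
  from Max_in[OF this] obtain v where v: "v \<in> set c"
      "root_distance f v = Max (root_distance f ` set c)"
    by auto
  then have vmax: "root_distance f u \<le> root_distance f v" if "u \<in> set c" for u
    using that by simp
  have up: "u = f v" if "u \<in> set c" "{v, u} \<in> parent_edges f" for u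
  proof (rule ccontr)
    assume "u \<noteq> f v"
    with that have "f u = v" "u \<noteq> v" by (auto simp: parent_edges_iff)
    then have "root_distance f u = Suc (root_distance f v)"
      using root_distance_Suc[of f u] assms by (auto simp: forest_map_def)
    with vmax[OF that(1)] show False by simp
  qed
  obtain i where i: "i < ?n" "c ! i = v" using v(1) by (auto simp: in_set_conv_nth)
  \<comment> \<open>\<open>a\<close> and \<open>b\<close> are the positions after and before
    \<open>i\<close>, with wrap-around at the two ends; they differ because the cycle has length at
    least 3.\<close>
  define a where "a = Suc i mod ?n"
  define b where "b = (if i = 0 then ?n - 1 else i - 1)"
  have a: "a = (if Suc i = ?n then 0 else Suc i)" using i(1) by (auto simp: a_def)
  have ab: "a < ?n" "b < ?n" "a \<noteq> b" using n i(1) by (auto simp: a b_def split: if_splits)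
  have "Suc b mod ?n = i" using i(1) n by (auto simp: b_def)
  then have "{v, c ! a} \<in> parent_edges f" "{v, c ! b} \<in> parent_edges f"
    using e[OF i(1)] e[OF ab(2)] i(2) by (simp_all add: a_def insert_commute)
  then have "c ! a = f v" "c ! b = f v" using ab by (simp_all add: up)
  with dist ab show False by (metis nth_eq_iff_index_eq)
qed

text \<open>The path is built backwards from \<open>v\<close>: a new first vertex is put in front
  or, if it already occurs, everything before its occurrence is dropped.\<close>

lemma rtrancl_distinct_path:
  assumes "(u, v) \<in> R\<^sup>*"
  shows "\<exists>p. p \<noteq> [] \<and> hd p = u \<and> last p = v \<and> distinct p \<and>
    (\<forall>i. Suc i < length p \<longrightarrow> (p ! i, p ! Suc i) \<in> R)"
  using assms
proof (induction rule: converse_rtrancl_induct)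
  case base
  then show ?case by (intro exI[of _ "[v]"]) auto
next
  case (step u w)
  then obtain p where p: "p \<noteq> []" "hd p = w" "last p = v" "distinct p"
      "\<And>i. Suc i < length p \<Longrightarrow> (p ! i, p ! Suc i) \<in> R"
    by blast
  show ?case
  proof (cases "u \<in> set p")
    case False
    have "((u # p) ! i, (u # p) ! Suc i) \<in> R" if "Suc i < length (u # p)" for i
      using that p step.hyps(1) by (cases i) (auto simp: hd_conv_nth)
    with p False show ?thesis by (intro exI[of _ "u # p"]) auto
  next
    case True
    then obtain k where k: "k < length p" "p ! k = u" by (auto simp: in_set_conv_nth)
    with p show ?thesis by (intro exI[of _ "drop k p"]) (auto simp: hd_drop_conv_nth)
  qed
qed

text \<open>The new edge closes up a distinct path from \<open>u\<close> to \<open>v\<close> in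
  \<open>F\<close>. This path has at least three vertices: one would give \<open>u = v\<close>, and
  two would put the edge into \<open>F\<close>.\<close>

lemma is_cycle_of_additional_edge:
  assumes "(u, v) \<in> {(x, y). {x, y} \<in> F}\<^sup>*" "{u, v} \<in> E" "{u, v} \<notin> F" "F \<subseteq> E" "u \<noteq> v"
  shows "\<exists>c. is_cycle E c"
proof -
  obtain p where p: "p \<noteq> []" "hd p = u" "last p = v" "distinct p"
      "\<And>i. Suc i < length p \<Longrightarrow> {p ! i, p ! Suc i} \<in> F"
    using rtrancl_distinct_path[OF assms(1)] by auto
  have u: "p ! 0 = u" and v: "p ! (length p - 1) = v"
    using p by (auto simp: hd_conv_nth last_conv_nth)
  have "length p \<noteq> 1" using u v assms(5) by auto
  moreover have "length p \<noteq> 2" using u v assms(3) p(5)[of 0] by auto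
  moreover have "length p \<noteq> 0" using p(1) by simp
  ultimately have "length p \<ge> 3" by linarith
  moreover have "{p ! i, p ! (Suc i mod length p)} \<in> E" if "i < length p" for i
  proof (cases "Suc i = length p")
    case True
    then show ?thesis using u v assms(2) by (metis diff_Suc_1 insert_commute mod_self)
  next
    case False
    then show ?thesis using that p(5)[of i] assms(4) by auto
  qed
  ultimately have "is_cycle E p" using p(4) by (simp add: is_cycle_def)
  then show ?thesis by blast
qed

text \<open>The points outside \<open>V\<close> are fixed by \<open>f\<close>, but the roots are those in \<open>V\<close>.\<close>

definition forest_maps :: "'v set \<Rightarrow> 'v set set \<Rightarrow> ('v \<Rightarrow> 'v) set" where
  "forest_maps V E = {f. forest_map f \<and> (\<forall>i. f i \<noteq> i \<longrightarrow> i \<in> V \<and> f i \<in> V \<and> {i, f i} \<in> E)}"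

definition roots :: "'v set \<Rightarrow> ('v \<Rightarrow> 'v) \<Rightarrow> 'v set" where
  "roots V f = {i \<in> V. f i = i}"

lemma roots_nonempty:
  assumes "f \<in> forest_maps V E" and "V \<noteq> {}"
  shows "roots V f \<noteq> {}"
proof -
  obtain i where "i \<in> V" using assms(2) by blast
  have "reaches_root f i" using assms(1) by (simp add: forest_maps_def forest_map_def)
  then have "i \<in> V \<longrightarrow> (\<exists>r\<in>V. f r = r)"
  proof (induction rule: reaches_root.induct)
    case (step i)
    then show ?case using assms(1) by (cases "f i = i") (auto simp: forest_maps_def)
  qed auto
  with \<open>i \<in> V\<close> show ?thesis by (auto simp: roots_def)
qed

text \<open>These are the rooted spanning trees with all edges directed towards the root.\<close>

definition arborescences :: "'v set \<Rightarrow> 'v set set \<Rightarrow> (('v \<Rightarrow> 'v) \<times> 'v) set" where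
  "arborescences V E = {(f, r). f \<in> forest_maps V E \<and> roots V f = {r}}"

text \<open>Following parents from any vertex of \<open>V\<close> ends at the only root, so all
  vertices are connected through \<open>r\<close>.\<close>

lemma arborescence_is_tree:
  assumes "(f, r) \<in> arborescences V E"
  shows "is_tree V (parent_edges f)"
proof -
  have f: "forest_map f" "\<And>i. f i \<noteq> i \<Longrightarrow> i \<in> V \<and> f i \<in> V" "r \<in> V" "\<And>i. i \<in> V \<Longrightarrow> f i = i \<Longrightarrow> i = r"
    using assms by (auto simp: arborescences_def forest_maps_def roots_def)
  let ?R = "{(x, y). {x, y} \<in> parent_edges f}"
  have to_root: "(u, r) \<in> ?R\<^sup>*" if "u \<in> V" for u
  proof -
    have "reaches_root f u" using f(1) by (simp add: forest_map_def)
    from this that show ?thesis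
    proof (induction rule: reaches_root.induct)
      case (root i)
      then show ?case using f(4) by blast
    next
      case (step i)
      show ?case
      proof (cases "f i = i")
        case False
        then have "(i, f i) \<in> ?R" by (auto simp: parent_edges_iff)
        with step f(2)[OF False] show ?thesis by (meson converse_rtrancl_into_rtrancl)
      qed (use step in simp)
    qed
  qed
  have "sym ?R" by (auto simp: sym_def insert_commute)
  then have "sym (?R\<^sup>*)" by (rule sym_rtrancl)
  then have "connected_graph V (parent_edges f)"
    unfolding connected_graph_def using to_root by (meson rtrancl_trans symD)
  with f not_is_cycle_parent_edges[OF f(1)] show ?thesis by (auto simp: is_tree_def)
qed

text \<open>Edges and root determine the orientation, by induction along the path to the root. The
  edge from \<open>i\<close> to \<open>f i\<close> is also a parent edge of \<open>g\<close>; if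
  \<open>g\<close> used it in the opposite direction, the induction hypothesis would make
  \<open>f\<close> swap \<open>i\<close> and \<open>f i\<close>.\<close>

lemma inj_on_arborescences:
  "inj_on (\<lambda>(f, r). (parent_edges f, r)) (arborescences V E)"
proof -
  have "f v = g v"
    if f: "(f, r) \<in> arborescences V E" and g: "(g, r) \<in> arborescences V E"
      and eq: "parent_edges f = parent_edges g" for f g r v
  proof -
    have F: "forest_map f" "\<And>i. f i \<noteq> i \<Longrightarrow> i \<in> V \<and> f i \<in> V" "f r = r" "\<And>i. i \<in> V \<Longrightarrow> f i = i \<Longrightarrow> i = r"
      using f by (auto simp: arborescences_def forest_maps_def roots_def)
    have G: "\<And>i. g i \<noteq> i \<Longrightarrow> i \<in> V \<and> g i \<in> V" "g r = r" "\<And>i. i \<in> V \<Longrightarrow> g i = i \<Longrightarrow> i = r"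
      using g by (auto simp: arborescences_def forest_maps_def roots_def)
    have "reaches_root f v" using F(1) by (simp add: forest_map_def)
    then show ?thesis
    proof (induction rule: reaches_root.induct)
      case (root i)
      then show ?case using F G by metis
    next
      case (step i)
      show ?case
      proof (cases "f i = i")
        case True
        then show ?thesis using F G by metis
      next
        case False
        then have "{i, f i} \<in> parent_edges g" by (simp add: eq[symmetric] parent_edges_iff)
        then consider "g i = f i" | "g (f i) = i" by (auto simp: parent_edges_iff)
        then show ?thesis
        proof cases
          case 2
          then have "f (f i) = i" using step.IH by simp
          \<comment> \<open>The depth would grow along both directions of the 2-cycle.\<close>
          then have "root_distance f i = Suc (Suc (root_distance f i))"
            using root_distance_Suc[of f i] root_distance_Suc[of f "f i"] False F(1)
            by (auto simp: forest_map_def)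
          then show ?thesis by simp
        qed simp
      qed
    qed
  qed
  then show ?thesis by (auto simp: inj_on_def fun_eq_iff)
qed

text \<open>The parent of a vertex is chosen as a neighbour in the tree that is closer to
  \<open>r\<close>, where \<open>d\<close> measures the distance to \<open>r\<close> in
  \<open>F\<close>.\<close>

lemma spanning_tree_is_arborescence:
  assumes F: "F \<subseteq> E" "is_tree V F" and r: "r \<in> V"
    and E: "\<And>u v. {u, v} \<in> E \<Longrightarrow> u \<in> V \<and> v \<in> V \<and> u \<noteq> v"
    and E2: "\<And>e. e \<in> E \<Longrightarrow> \<exists>u v. e = {u, v}"
  shows "\<exists>f. (f, r) \<in> arborescences V E \<and> parent_edges f = F"
proof -
  let ?R = "{(x, y). {x, y} \<in> F}"
  have reach: "\<exists>k. (v, r) \<in> ?R ^^ k" if "v \<in> V" for v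
    using F(2) r that by (auto simp: is_tree_def connected_graph_def rtrancl_power)
  define d where "d v = (LEAST k. (v, r) \<in> ?R ^^ k)" for v
  have d: "(v, r) \<in> ?R ^^ d v" if "v \<in> V" for v
    using reach[OF that] unfolding d_def by (rule LeastI_ex)
  have "\<exists>w. {v, w} \<in> F \<and> d w < d v" if "v \<in> V" "v \<noteq> r" for v
  proof -
    have "d v \<noteq> 0" using d[OF that(1)] that(2) by (metis relpow_0_E)
    then obtain k where k: "d v = Suc k" using not0_implies_Suc by blast
    with d[OF that(1)] obtain w where w: "(v, w) \<in> ?R" "(w, r) \<in> ?R ^^ k"
      by (metis relpow_Suc_E2)
    have "d w \<le> k" unfolding d_def using w(2) by (rule Least_le)
    with w k show ?thesis by auto
  qed
  then have "\<forall>v\<in>V - {r}. \<exists>w. {v, w} \<in> F \<and> d w < d v" by blast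
  from bchoice[OF this] obtain g
    where g: "\<And>v. v \<in> V \<Longrightarrow> v \<noteq> r \<Longrightarrow> {v, g v} \<in> F \<and> d (g v) < d v" by blast
  \<comment> \<open>The root \<open>r\<close> and all points outside \<open>V\<close> are fixed, as
    \<open>arborescences\<close> requires.\<close>
  define f where "f v = (if v \<in> V \<and> v \<noteq> r then g v else v)" for v
  have "reaches_root f v" for v
  proof (induction "d v" arbitrary: v rule: less_induct)
    case less
    show ?case
    proof (cases "v \<in> V \<and> v \<noteq> r")
      case True
      then have "reaches_root f (f v)" using less[of "g v"] g[of v] by (simp add: f_def)
      then show ?thesis by (rule reaches_root.step)
    qed (auto intro: reaches_root.root simp: f_def)
  qed
  then have forest: "forest_map f" by (simp add: forest_map_def)
  have sub: "parent_edges f \<subseteq> F" using g by (auto simp: parent_edges_def f_def split: if_splits)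
  have arb: "(f, r) \<in> arborescences V E"
    using forest g F(1) E r
    by (auto simp: arborescences_def forest_maps_def roots_def f_def split: if_splits)
       (metis E F(1) g subsetD)+
  \<comment> \<open>The parent edges already connect \<open>V\<close>, so a further edge of
    \<open>F\<close> would close a cycle in \<open>F\<close>.\<close>
  have "F \<subseteq> parent_edges f"
  proof
    fix e assume e: "e \<in> F"
    then obtain u v where uv: "e = {u, v}" using E2 F(1) by blast
    show "e \<in> parent_edges f"
    proof (rule ccontr)
      assume "e \<notin> parent_edges f"
      moreover have "(u, v) \<in> {(x, y). {x, y} \<in> parent_edges f}\<^sup>*"
        using arborescence_is_tree[OF arb] E[of u v] F(1) e uv
        by (auto simp: is_tree_def connected_graph_def)
      ultimately have "\<exists>c. is_cycle F c"
        using is_cycle_of_additional_edge[of u v "parent_edges f" F] E[of u v] F(1) e uv sub by auto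
      with F(2) show False by (simp add: is_tree_def)
    qed
  qed
  with sub arb show ?thesis by blast
qed

theorem card_rooted_spanning_trees:
  assumes E: "\<And>u v. {u, v} \<in> E \<Longrightarrow> u \<in> V \<and> v \<in> V \<and> u \<noteq> v"
    and E2: "\<And>e. e \<in> E \<Longrightarrow> \<exists>u v. e = {u, v}"
  shows "card (rooted_spanning_trees V E) = card {f \<in> forest_maps V E. card (roots V f) = 1}"
proof -
  have "(\<lambda>(f, r). (parent_edges f, r)) ` arborescences V E = rooted_spanning_trees V E"
  proof (intro equalityI subsetI)
    fix x assume "x \<in> (\<lambda>(f, r). (parent_edges f, r)) ` arborescences V E"
    then obtain f r where fr: "(f, r) \<in> arborescences V E" "x = (parent_edges f, r)" by auto
    then show "x \<in> rooted_spanning_trees V E"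
      using arborescence_is_tree[OF fr(1)]
      by (auto simp: rooted_spanning_trees_def spanning_trees_def arborescences_def forest_maps_def
          roots_def parent_edges_def)
  next
    fix x assume "x \<in> rooted_spanning_trees V E"
    then obtain F r where x: "x = (F, r)" "F \<subseteq> E" "is_tree V F" "r \<in> V"
      by (auto simp: rooted_spanning_trees_def spanning_trees_def)
    from spanning_tree_is_arborescence[OF x(2-4) E E2] x(1)
    show "x \<in> (\<lambda>(f, r). (parent_edges f, r)) ` arborescences V E" by force
  qed
  then have "card (rooted_spanning_trees V E) = card (arborescences V E)"
    using card_image[OF inj_on_arborescences[of V E]] by simp
  \<comment> \<open>The root is determined by \<open>f\<close>, so the pair can be replaced by
    \<open>f\<close> alone.\<close>
  also have "\<dots> = card (fst ` arborescences V E)"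
    by (intro card_image[symmetric]) (auto simp: inj_on_def arborescences_def)
  also have "fst ` arborescences V E = {f \<in> forest_maps V E. card (roots V f) = 1}"
    by (force simp: arborescences_def card_1_singleton_iff image_iff)
  finally show ?thesis .
qed

section \<open>Biregular incidence structures\<close>

text \<open>The generating function of the rooted spanning forests by number of roots, which is
  \<open>det (t + L)\<close> for the Laplacian \<open>L\<close> of the graph.\<close>

definition forest_polynomial :: "'v set \<Rightarrow> 'v set set \<Rightarrow> real \<Rightarrow> real" where
  "forest_polynomial V E t = (\<Sum>f\<in>forest_maps V E. t ^ card (roots V f))"

text \<open>Rows and columns both range over the whole type, with zeros outside \<open>W\<close>
  times \<open>V\<close>, so that the two products of the matrix with its transpose have the same
  size.\<close>

definition incidence_matrix :: "'v set \<Rightarrow> 'v set \<Rightarrow> ('v \<Rightarrow> 'v \<Rightarrow> bool) \<Rightarrow> real ^ 'v ^ 'v::finite" where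
  "incidence_matrix W V I = (\<chi> A X. if A \<in> W \<and> X \<in> V \<and> I A X then 1 else 0)"

lemma transpose_incidence_matrix:
  "transpose (incidence_matrix W V I) = incidence_matrix V W (\<lambda>X A. I A X)"
  by (auto simp: incidence_matrix_def transpose_def vec_eq_iff)

text \<open>A nonzero term in an entry of the square needs a middle index in both \<open>V\<close>
  and \<open>W\<close>. This provides the nilpotency hypotheses of
  \<open>det_diff_mult_commute\<close>.\<close>

lemma incidence_matrix_square_zero:
  assumes "V \<inter> W = {}"
  shows "incidence_matrix W V I ** incidence_matrix W V I = 0"
  using assms by (auto simp: incidence_matrix_def matrix_matrix_mult_def vec_eq_iff intro!: sum.neutral)

lemma transpose_incidence_matrix_mult_nth:
  "(transpose (incidence_matrix W V I) ** incidence_matrix W V I) $ X $ Y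
    = (if X \<in> V \<and> Y \<in> V then real (card {A \<in> W. I A X \<and> I A Y}) else 0)"
proof -
  have "(transpose (incidence_matrix W V I) ** incidence_matrix W V I) $ X $ Y
      = (\<Sum>A\<in>UNIV. if A \<in> {A \<in> W. X \<in> V \<and> Y \<in> V \<and> I A X \<and> I A Y} then 1 else 0)"
    unfolding matrix_matrix_mult_def transpose_def incidence_matrix_def
    by (simp, rule sum.cong) auto
  also have "\<dots> = real (card {A \<in> W. X \<in> V \<and> Y \<in> V \<and> I A X \<and> I A Y})"
    by (subst sum.inter_filter[symmetric]) auto
  finally show ?thesis by auto
qed

text \<open>The row sums of \<open>N\<^sup>T N\<close> are \<open>a * b\<close> on \<open>V\<close>, so that \<open>a * b - N\<^sup>T N\<close> restricted to \<open>V\<close> is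
  the Laplacian of the graph \<open>(V, E)\<close>.\<close>

lemma det_diff_incidence_matrix:
  fixes V W :: "'v::finite set"
  assumes a: "\<And>X. X \<in> V \<Longrightarrow> card {A \<in> W. I A X} = a"
    and b: "\<And>A. A \<in> W \<Longrightarrow> card {X \<in> V. I A X} = b"
    and E: "\<And>X Y. X \<in> V \<Longrightarrow> Y \<in> V \<Longrightarrow> X \<noteq> Y \<Longrightarrow>
      card {A \<in> W. I A X \<and> I A Y} = (if {X, Y} \<in> E then 1 else 0)"
  defines "N \<equiv> incidence_matrix W V I"
  shows "det (mat (t + a * b) - transpose N ** N)
    = (t + a * b) ^ card (- V) * forest_polynomial V E t"
proof -
  define w where "w X Y = (transpose N ** N) $ X $ Y" for X Y
  \<comment> \<open>On \<open>V\<close> the edge weights absorb the row sum \<open>a * b\<close>,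
    leaving \<open>t\<close> as root weight. Outside \<open>V\<close> the row of
    \<open>transpose N ** N\<close> vanishes, so the whole diagonal entry is root weight.\<close>
  define s where "s X = (if X \<in> V then t else t + a * b)" for X
  have w: "w X Y = (if X \<in> V \<and> Y \<in> V then real (card {A \<in> W. I A X \<and> I A Y}) else 0)" for X Y
    unfolding w_def N_def by (rule transpose_incidence_matrix_mult_nth)
  have row_sum: "sum (w X) UNIV = (if X \<in> V then a * b else 0)" for X
  proof -
    have N_row: "(\<Sum>Y\<in>UNIV. N $ A $ Y) = (if A \<in> W then b else 0)" for A
      using b[of A] by (auto simp: N_def incidence_matrix_def simp flip: sum.inter_filter)
    have N_col: "(\<Sum>A\<in>UNIV. N $ A $ X) = (if X \<in> V then a else 0)"
      using a[of X] by (auto simp: N_def incidence_matrix_def simp flip: sum.inter_filter)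
    have "sum (w X) UNIV = (\<Sum>A\<in>UNIV. N $ A $ X * (\<Sum>Y\<in>UNIV. N $ A $ Y))"
      unfolding w_def matrix_matrix_mult_def transpose_def
      by (simp add: sum_distrib_left) (rule sum.swap)
    \<comment> \<open>The inner sum may be replaced by \<open>b\<close> for every \<open>A\<close>,
      because \<open>N $ A $ X\<close> is zero for \<open>A\<close> outside
      \<open>W\<close>.\<close>
    also have "\<dots> = (\<Sum>A\<in>UNIV. N $ A $ X * b)"
      unfolding N_row by (rule sum.cong) (auto simp: N_def incidence_matrix_def)
    also have "\<dots> = (if X \<in> V then a * b else 0)"
      by (simp add: N_col flip: sum_distrib_right)
    finally show ?thesis .
  qed
  \<comment> \<open>A map in \<open>forest_maps V E\<close> moves points only along edges, which
    have weight 1, so only its fixed points contribute. Any other forest map uses some pair of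
    weight 0.\<close>
  have prod: "(\<Prod>i\<in>UNIV. if f i = i then s i else w i (f i))
      = (if f \<in> forest_maps V E then (t + a * b) ^ card (- V) * t ^ card (roots V f) else 0)"
    if forest: "forest_map f" for f
  proof (cases "f \<in> forest_maps V E")
    case True
    have "(\<Prod>i\<in>UNIV. if f i = i then s i else w i (f i))
        = (\<Prod>i\<in>UNIV. (if i \<in> - V then t + a * b else 1) * (if i \<in> roots V f then t else 1))"
    proof (rule prod.cong)
      fix i
      show "(if f i = i then s i else w i (f i))
          = (if i \<in> - V then t + a * b else 1) * (if i \<in> roots V f then t else 1)"
      proof (cases "f i = i")
        case False
        then have "i \<in> V" "f i \<in> V" "{i, f i} \<in> E" using True by (auto simp: forest_maps_def)
        with False show ?thesis using E[of i "f i"] by (simp add: w roots_def)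
      qed (simp add: s_def roots_def)
    qed simp
    also have "\<dots> = (t + a * b) ^ card (- V) * t ^ card (roots V f)"
      by (simp add: prod.distrib prod.If_cases Compl_eq)
    finally show ?thesis using True by simp
  next
    case False
    then obtain i where i: "f i \<noteq> i" "\<not> (i \<in> V \<and> f i \<in> V \<and> {i, f i} \<in> E)"
      using forest by (auto simp: forest_maps_def)
    then have "w i (f i) = 0" using E[of i "f i"] by (auto simp: w)
    with i(1) have "\<exists>i\<in>UNIV. (if f i = i then s i else w i (f i)) = 0" by auto
    with False show ?thesis by (simp add: prod_zero)
  qed
  have "mat (t + a * b) - transpose N ** N
      = (\<chi> i j. if i = j then s i + (\<Sum>k\<in>UNIV - {i}. w i k) else - w i j)"
  proof -
    have "t + a * b - w i i = s i + (\<Sum>k\<in>UNIV - {i}. w i k)" for i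
      using row_sum[of i] sum.remove[of UNIV i "w i"] w[of i i] by (auto simp: s_def split: if_splits)
    then show ?thesis by (simp add: vec_eq_iff mat_def w_def)
  qed
  then have "det (mat (t + a * b) - transpose N ** N)
      = (\<Sum>f | forest_map f. \<Prod>i\<in>UNIV. if f i = i then s i else w i (f i))"
    by (simp add: weighted_matrix_forest)
  also have "\<dots> = (\<Sum>f | forest_map f.
      if f \<in> forest_maps V E then (t + a * b) ^ card (- V) * t ^ card (roots V f) else 0)"
    by (rule sum.cong) (auto simp: prod)
  also have "\<dots> = (\<Sum>f\<in>forest_maps V E. (t + a * b) ^ card (- V) * t ^ card (roots V f))"
    by (rule sum.mono_neutral_cong_right) (auto simp: forest_maps_def)
  finally show ?thesis by (simp add: forest_polynomial_def sum_distrib_left)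
qed

text \<open>Every forest on a nonempty \<open>V\<close> has a root, so the polynomial is divisible
  by \<open>t\<close>. At 0 the quotient keeps exactly the forests with a single root.\<close>

lemma tendsto_forest_polynomial_divide:
  fixes V :: "'v::finite set"
  assumes "V \<noteq> {}"
  shows "((\<lambda>t. forest_polynomial V E t / t) \<longlongrightarrow>
    real (card {f \<in> forest_maps V E. card (roots V f) = 1})) (at_right 0)"
proof -
  \<comment> \<open>By \<open>pos\<close> below, the subtraction in the exponent never truncates,
    and \<open>0 ^ 0 = 1\<close> counts the forests with one root.\<close>
  let ?Q = "\<lambda>t :: real. \<Sum>f\<in>forest_maps V E. t ^ (card (roots V f) - 1)"
  have pos: "card (roots V f) \<ge> 1" if "f \<in> forest_maps V E" for f
    using roots_nonempty[OF that assms] by (simp add: Suc_le_eq card_gt_0_iff)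
  have "isCont ?Q 0" by (intro continuous_intros)
  then have "(?Q \<longlongrightarrow> ?Q 0) (at_right 0)"
    by (simp add: isCont_def filterlim_at_split)
  moreover have "?Q 0 = (\<Sum>f\<in>forest_maps V E. if card (roots V f) = 1 then 1 else 0)"
    using pos by (intro sum.cong) (auto simp: power_0_left le_antisym)
  moreover have "\<dots> = real (card {f \<in> forest_maps V E. card (roots V f) = 1})"
    by (simp flip: sum.inter_filter)
  moreover have "?Q t = forest_polynomial V E t / t" if "t > 0" for t
  proof -
    have "t ^ (card (roots V f) - 1) = t ^ card (roots V f) / t" if "f \<in> forest_maps V E" for f
      using pos[OF that] \<open>t > 0\<close> by (simp add: power_diff)
    then show ?thesis by (simp add: forest_polynomial_def sum_divide_distrib)
  qed
  then have "eventually (\<lambda>t. ?Q t = forest_polynomial V E t / t) (at_right 0)"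
    by (simp add: eventually_at_right_less eventually_at_right_field) (metis zero_less_one)
  ultimately show ?thesis by (simp add: tendsto_cong)
qed

text \<open>The linear coefficients are compared by dividing by \<open>t > 0\<close> and letting
  \<open>t\<close> tend to 0 from the right.\<close>

theorem rooted_spanning_trees_of_biregular_incidence:
  fixes V W :: "'v::finite set"
  assumes disjoint: "V \<inter> W = {}" and ne: "V \<noteq> {}" "W \<noteq> {}" and pos: "a > 0" "b > 0"
    and a: "\<And>X. X \<in> V \<Longrightarrow> card {A \<in> W. I A X} = a"
    and b: "\<And>A. A \<in> W \<Longrightarrow> card {X \<in> V. I A X} = b"
    and E: "\<And>X Y. X \<in> V \<Longrightarrow> Y \<in> V \<Longrightarrow> X \<noteq> Y \<Longrightarrow>
      card {A \<in> W. I A X \<and> I A Y} = (if {X, Y} \<in> E then 1 else 0)"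
    and F: "\<And>A B. A \<in> W \<Longrightarrow> B \<in> W \<Longrightarrow> A \<noteq> B \<Longrightarrow>
      card {X \<in> V. I A X \<and> I B X} = (if {A, B} \<in> F then 1 else 0)"
    and E_edges: "\<And>u v. {u, v} \<in> E \<Longrightarrow> u \<in> V \<and> v \<in> V \<and> u \<noteq> v"
      "\<And>e. e \<in> E \<Longrightarrow> \<exists>u v. e = {u, v}"
    and F_edges: "\<And>u v. {u, v} \<in> F \<Longrightarrow> u \<in> W \<and> v \<in> W \<and> u \<noteq> v"
      "\<And>e. e \<in> F \<Longrightarrow> \<exists>u v. e = {u, v}"
  shows "card (rooted_spanning_trees V E) * (a * b) ^ card W
    = card (rooted_spanning_trees W F) * (a * b) ^ card V"
proof -
  define c :: real where "c = a * b"
  have c: "c > 0" using pos by (simp add: c_def)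
  let ?N = "incidence_matrix W V I"
  have eq: "(t + c) ^ card W * (forest_polynomial V E t / t)
      = (t + c) ^ card V * (forest_polynomial W F t / t)" if "t > 0" for t
  proof -
    have "(t + c) ^ card (- V) * forest_polynomial V E t = det (mat (t + c) - transpose ?N ** ?N)"
      using det_diff_incidence_matrix[of V W I a b E t] a b E by (simp add: c_def)
    also have "\<dots> = det (mat (t + c) - ?N ** transpose ?N)"
      using c that disjoint
      by (intro det_diff_mult_commute)
         (auto simp: transpose_incidence_matrix intro!: incidence_matrix_square_zero)
    also have "\<dots> = (t + c) ^ card (- W) * forest_polynomial W F t"
      using det_diff_incidence_matrix[of W V "\<lambda>X A. I A X" b a F t] a b F
      by (simp add: c_def mult.commute transpose_incidence_matrix)
    \<comment> \<open>Multiplying by \<open>(t + c) ^ (card V + card W)\<close> turns the surplus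
      factor on each side into \<open>(t + c) ^ CARD('v)\<close>, which cancels.\<close>
    finally have "(t + c) ^ (card V + card (- V)) * ((t + c) ^ card W * forest_polynomial V E t)
        = (t + c) ^ (card W + card (- W)) * ((t + c) ^ card V * forest_polynomial W F t)"
      by (simp add: power_add mult_ac)
    moreover have "card S + card (- S) = CARD('v)" for S :: "'v set"
      using card_Un_disjoint[of S "- S"] by (simp add: Compl_partition)
    ultimately show ?thesis using c that by simp
  qed
  let ?R = "\<lambda>V E. real (card (rooted_spanning_trees V E))"
  have lim: "((\<lambda>t. (t + c) ^ k * (forest_polynomial V' E' t / t)) \<longlongrightarrow> (0 + c) ^ k * ?R V' E') (at_right 0)"
    if "V' \<noteq> {}" "\<And>u v. {u, v} \<in> E' \<Longrightarrow> u \<in> V' \<and> v \<in> V' \<and> u \<noteq> v"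
      "\<And>e. e \<in> E' \<Longrightarrow> \<exists>u v. e = {u, v}" for k and V' :: "'v set" and E'
    using tendsto_forest_polynomial_divide[OF that(1), of E'] card_rooted_spanning_trees[of E' V'] that(2,3)
    by (intro tendsto_intros) auto
  have "eventually (\<lambda>t. (t + c) ^ card W * (forest_polynomial V E t / t)
      = (t + c) ^ card V * (forest_polynomial W F t / t)) (at_right 0)"
    using eq by (simp add: eventually_at_right_field) (metis zero_less_one)
  note cong = tendsto_cong[OF this]
  have "(0 + c) ^ card W * ?R V E = (0 + c) ^ card V * ?R W F"
    by (rule tendsto_unique[OF _ cong[THEN iffD1, OF lim[OF ne(1) E_edges]] lim[OF ne(2) F_edges]])
      simp
  then have "real (card (rooted_spanning_trees V E) * (a * b) ^ card W)
      = real (card (rooted_spanning_trees W F) * (a * b) ^ card V)"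
    by (simp add: c_def mult_ac)
  then show ?thesis by (simp only: of_nat_eq_iff)
qed

section \<open>Subspaces of a finite vector space\<close>

lemma grassmann_edges_iff:
  "{X, Y} \<in> grassmann_edges m \<longleftrightarrow> X \<in> Bq m \<and> Y \<in> Bq m \<and> vec.dim (X \<inter> Y) + 1 = m"
  by (auto simp: grassmann_edges_def doubleton_eq_iff Int_commute)

lemma grassmann_edges_distinct:
  assumes "{X, Y} \<in> grassmann_edges m"
  shows "X \<in> Bq m \<and> Y \<in> Bq m \<and> X \<noteq> Y"
  using assms by (auto simp: grassmann_edges_iff Bq_def)

lemma Bq_eqI: "X \<in> Bq k \<Longrightarrow> Y \<in> Bq k \<Longrightarrow> X \<subseteq> Y \<Longrightarrow> X = Y"
  using vec.subspace_dim_equal[of X Y] by (simp add: Bq_def)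

lemma dim_Int_less:
  assumes "X \<in> Bq k" "Y \<in> Bq k" "X \<noteq> Y"
  shows "vec.dim (X \<inter> Y) < k"
proof (rule ccontr)
  assume "\<not> vec.dim (X \<inter> Y) < k"
  moreover have "vec.dim (X \<inter> Y) \<le> k"
    using assms(1) vec.dim_subset[of "X \<inter> Y" X] by (simp add: Bq_def)
  ultimately have "X \<inter> Y \<in> Bq k"
    using assms by (auto simp: Bq_def intro: vec.subspace_inter)
  then have "X \<inter> Y = X" "X \<inter> Y = Y" using assms Bq_eqI by blast+
  with assms(3) show False by simp
qed

text \<open>Every candidate lies in \<open>X \<inter> Y\<close>, whose dimension is below
  \<open>m\<close>. If the dimension is \<open>m - 1\<close>, the intersection is the only
  candidate; if it is smaller, there is none.\<close>

lemma card_common_hyperplanes: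
  fixes X Y :: "('a::{field,finite} ^ 'n::finite) set"
  assumes "m \<ge> 1" "X \<in> Bq m" "Y \<in> Bq m" "X \<noteq> Y"
  shows "card {A \<in> Bq (m - 1). A \<subseteq> X \<and> A \<subseteq> Y} = (if {X, Y} \<in> grassmann_edges m then 1 else 0)"
proof (cases "vec.dim (X \<inter> Y) + 1 = m")
  case True
  then have XY: "X \<inter> Y \<in> Bq (m - 1)"
    using assms by (auto simp: Bq_def intro: vec.subspace_inter)
  then have "{A \<in> Bq (m - 1). A \<subseteq> X \<and> A \<subseteq> Y} = {X \<inter> Y}"
    using Bq_eqI[OF _ XY] by blast
  with True assms show ?thesis by (simp add: grassmann_edges_iff)
next
  case False
  then have "vec.dim (X \<inter> Y) < m - 1" using dim_Int_less[OF assms(2-4)] by simp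
  then have "\<not> (A \<subseteq> X \<and> A \<subseteq> Y)" if "A \<in> Bq (m - 1)" for A
    using that vec.dim_subset[of A "X \<inter> Y"] by (auto simp: Bq_def)
  then have "{A \<in> Bq (m - 1). A \<subseteq> X \<and> A \<subseteq> Y} = {}" by blast
  with False show ?thesis by (simp only: grassmann_edges_iff) simp
qed

lemma dim_span_Un_Int:
  fixes A B :: "('a::{field,finite} ^ 'n::finite) set"
  assumes "vec.subspace A" "vec.subspace B"
  shows "vec.dim (vec.span (A \<union> B)) + vec.dim (A \<inter> B) = vec.dim A + vec.dim B"
proof -
  have "vec.span (A \<union> B) = {x + y |x y. x \<in> A \<and> y \<in> B}"
    using assms by (simp only: vec.span_Un vec.span_eq_iff[THEN iffD2])
  with vec.dim_sums_Int[OF assms] show ?thesis by simp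
qed

text \<open>Dually, every candidate contains the span of \<open>A \<union> B\<close>, whose
  dimension \<open>2 * k - dim (A \<inter> B)\<close> is at least \<open>Suc k\<close>, with
  equality iff \<open>A\<close> and \<open>B\<close> are adjacent.\<close>

lemma card_common_covers:
  fixes A B :: "('a::{field,finite} ^ 'n::finite) set"
  assumes "A \<in> Bq k" "B \<in> Bq k" "A \<noteq> B"
  shows "card {X \<in> Bq (Suc k). A \<subseteq> X \<and> B \<subseteq> X} = (if {A, B} \<in> grassmann_edges k then 1 else 0)"
proof -
  let ?S = "vec.span (A \<union> B)"
  have dim: "vec.dim ?S + vec.dim (A \<inter> B) = k + k"
    using dim_span_Un_Int[of A B] assms by (simp add: Bq_def)
  have S: "?S \<subseteq> X" if "X \<in> Bq (Suc k)" "A \<subseteq> X" "B \<subseteq> X" for X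
    using that by (intro vec.span_minimal) (auto simp: Bq_def)
  have AB: "A \<subseteq> ?S" "B \<subseteq> ?S" using vec.span_superset by blast+
  show ?thesis
  proof (cases "vec.dim (A \<inter> B) + 1 = k")
    case True
    then have span: "?S \<in> Bq (Suc k)" using dim by (simp add: Bq_def)
    have "{X \<in> Bq (Suc k). A \<subseteq> X \<and> B \<subseteq> X} = {?S}"
    proof (intro equalityI subsetI)
      fix X assume "X \<in> {X \<in> Bq (Suc k). A \<subseteq> X \<and> B \<subseteq> X}"
      then show "X \<in> {?S}" using Bq_eqI[OF span, of X] S[of X] by simp
    qed (use span AB in simp)
    with True assms show ?thesis by (simp add: grassmann_edges_iff)
  next
    case False
    then have "vec.dim ?S > Suc k" using dim dim_Int_less[OF assms] by simp
    then have "\<not> ?S \<subseteq> X" if "X \<in> Bq (Suc k)" for X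
      using that vec.dim_subset[of ?S X] by (auto simp: Bq_def)
    then have "{X \<in> Bq (Suc k). A \<subseteq> X \<and> B \<subseteq> X} = {}" using S by auto
    with False show ?thesis by (simp only: grassmann_edges_iff) simp
  qed
qed

text \<open>A bijection between bases extends to an injective linear map. So the general linear
  group is transitive on the subspaces of each dimension, which makes the incidence relation
  biregular.\<close>

lemma linear_automorphism_Bq:
  fixes X Y :: "('a::{field,finite} ^ 'n::finite) set"
  assumes "X \<in> Bq m" "Y \<in> Bq m"
  shows "\<exists>g. Vector_Spaces.linear (*s) (*s) g \<and> inj g \<and> g ` X = Y"
proof -
  obtain B where B: "B \<subseteq> X" "vec.independent B" "X \<subseteq> vec.span B" "card B = m"
    using vec.basis_exists[of X] assms by (auto simp: Bq_def)
  obtain C where C: "C \<subseteq> Y" "vec.independent C" "Y \<subseteq> vec.span C" "card C = m"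
    using vec.basis_exists[of Y] assms by (auto simp: Bq_def)
  obtain h where h: "bij_betw h B C"
    using finite_same_card_bij[of B C] B C by (auto simp: vec.finiteI_independent)
  then obtain g where g: "Vector_Spaces.linear (*s) (*s) g" "inj g" "\<forall>x\<in>B. g x = h x"
    using vec.linear_independent_extend_inj[of B h] B C by (auto simp: bij_betw_def)
  have "g ` B = C" using g(3) h by (auto simp: bij_betw_def image_iff)
  have "g ` X = g ` vec.span B" 
    using B assms(1) vec.span_subspace[of B X] by (simp add: Bq_def)
  also have "\<dots> = vec.span C" using vec.linear_span_image[OF g(1)] \<open>g ` B = C\<close> by metis
  also have "\<dots> = Y" using C assms(2) vec.span_subspace[of C Y] by (simp add: Bq_def)
  finally show ?thesis using g by blast
qed

lemma image_in_Bq: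
  assumes "Vector_Spaces.linear (*s) (*s) g" "inj g" "X \<in> Bq k"
  shows "g ` X \<in> Bq k"
proof -
  have "vec.dim (g ` X) = vec.dim X"
    by (rule vec.dim_image_eq[OF assms(1) inj_on_subset[OF assms(2)]]) simp
  moreover have "vec.subspace (g ` X)"
    using assms(3) by (intro vec.linear_subspace_image[OF assms(1)]) (simp add: Bq_def)
  ultimately show ?thesis using assms(3) by (simp add: Bq_def)
qed

text \<open>An injective linear map carrying \<open>X\<close> to \<open>Y\<close> acts injectively
  on subspaces and preserves dimension and inclusion. Exchanging \<open>X\<close> and
  \<open>Y\<close> then gives equality.\<close>

lemma card_subspaces_mono:
  fixes X Y :: "('a::{field,finite} ^ 'n::finite) set"
  assumes "X \<in> Bq m" "Y \<in> Bq m"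
  shows "card {A \<in> Bq k. A \<subseteq> X} \<le> card {A \<in> Bq k. A \<subseteq> Y}"
    and "card {A \<in> Bq k. X \<subseteq> A} \<le> card {A \<in> Bq k. Y \<subseteq> A}"
proof -
  obtain g where g: "Vector_Spaces.linear (*s) (*s) g" "inj g" "g ` X = Y"
    using linear_automorphism_Bq[OF assms] by blast
  have "inj_on ((`) g) S" for S using g(2) by (simp add: inj_on_def inj_image_eq_iff)
  moreover have "(`) g ` {A \<in> Bq k. A \<subseteq> X} \<subseteq> {A \<in> Bq k. A \<subseteq> Y}"
    "(`) g ` {A \<in> Bq k. X \<subseteq> A} \<subseteq> {A \<in> Bq k. Y \<subseteq> A}"
    using g by (auto simp: image_in_Bq)
  ultimately show "card {A \<in> Bq k. A \<subseteq> X} \<le> card {A \<in> Bq k. A \<subseteq> Y}"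
    and "card {A \<in> Bq k. X \<subseteq> A} \<le> card {A \<in> Bq k. Y \<subseteq> A}"
    by (auto intro!: card_inj_on_le[where f = "(`) g"])
qed

lemma card_subspaces_eq:
  fixes X Y :: "('a::{field,finite} ^ 'n::finite) set"
  assumes "X \<in> Bq m" "Y \<in> Bq m"
  shows "card {A \<in> Bq k. A \<subseteq> X} = card {A \<in> Bq k. A \<subseteq> Y}"
    and "card {A \<in> Bq k. X \<subseteq> A} = card {A \<in> Bq k. Y \<subseteq> A}"
  using card_subspaces_mono[OF assms] card_subspaces_mono[OF assms(2,1)] by (auto intro: le_antisym)

section \<open>Existence of subspaces of prescribed dimension\<close>

lemma independent_span_in_Bq:
  "vec.independent B \<Longrightarrow> vec.span B \<in> Bq (card B)"
  by (simp add: Bq_def vec.dim_eq_card_independent)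

text \<open>A basis of \<open>A\<close> is extended to a basis of \<open>C\<close>, and a set of
  size \<open>j\<close> between the two bases spans the required subspace.\<close>

lemma subspace_between:
  fixes A C :: "('a::{field,finite} ^ 'n::finite) set"
  assumes "A \<in> Bq i" "C \<in> Bq k" "A \<subseteq> C" "i \<le> j" "j \<le> k"
  shows "\<exists>X\<in>Bq j. A \<subseteq> X \<and> X \<subseteq> C"
proof -
  obtain B where B: "B \<subseteq> A" "vec.independent B" "A \<subseteq> vec.span B" "card B = i"
    using vec.basis_exists[of A] assms by (auto simp: Bq_def)
  obtain D where D: "B \<subseteq> D" "D \<subseteq> C" "vec.independent D" "C \<subseteq> vec.span D"
    using vec.maximal_independent_subset_extend[of B C] B assms(3) by blast
  have "card D = k"
    using vec.basis_card_eq_dim[OF D(2,4,3)] assms(2) by (simp add: Bq_def)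
  then obtain K where K: "B \<subseteq> K" "K \<subseteq> D" "card K = j"
    using exists_subset_between[of B j D] B(4) D assms by (auto simp: vec.finiteI_independent)
  have "vec.span K \<in> Bq j"
    using independent_span_in_Bq[of K] vec.independent_mono[OF D(3) K(2)] K(3) by simp
  moreover have "A \<subseteq> vec.span K" using B(3) vec.span_mono[OF K(1)] by blast
  moreover have "vec.span K \<subseteq> C"
    using K D assms(2) by (intro vec.span_minimal) (auto simp: Bq_def)
  ultimately show ?thesis by blast
qed

lemma zero_UNIV_in_Bq:
  "{0 :: 'a::{field,finite} ^ 'n::finite} \<in> Bq 0" "(UNIV :: ('a ^ 'n) set) \<in> Bq CARD('n)"
  by (simp_all add: Bq_def card_cart_basis)

lemma Bq_disjoint: "j \<noteq> k \<Longrightarrow> Bq j \<inter> Bq k = {}"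
  by (auto simp: Bq_def)

section \<open>Sizes of the sets \<open>UD\<close> and \<open>DU\<close>, and the final
  count\<close>

lemma card_UD:
  fixes X :: "('a::{field,finite} ^ 'n::finite) set"
  assumes "card {Y \<in> Bq (k - 1). Y \<subseteq> X} = a"
    and "\<And>Y :: ('a ^ 'n) set. Y \<in> Bq (k - 1) \<Longrightarrow> card {Z \<in> Bq k. Y \<subseteq> Z} = b"
  shows "card (UD k X) = a * b"
proof -
  have "UD k X = (SIGMA Y:{Y \<in> Bq (k - 1). Y \<subseteq> X}. {Z \<in> Bq k. Y \<subseteq> Z})"
    by (auto simp: UD_def)
  then show ?thesis using assms by simp
qed

lemma card_DU:
  fixes X :: "('a::{field,finite} ^ 'n::finite) set"
  assumes "card {Y \<in> Bq k. X \<subseteq> Y} = b"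
    and "\<And>Y :: ('a ^ 'n) set. Y \<in> Bq k \<Longrightarrow> card {Z \<in> Bq (k - 1). Z \<subseteq> Y} = a"
  shows "card (DU k X) = a * b"
proof -
  have "DU k X = (SIGMA Y:{Y \<in> Bq k. X \<subseteq> Y}. {Z \<in> Bq (k - 1). Z \<subseteq> Y})"
    by (auto simp: DU_def)
  then show ?thesis using assms by simp
qed

theorem theorem3p3:
  fixes m :: nat
  assumes "1 \<le> m" and "2 * m \<le> CARD('n::finite)"
  shows "(Tq m :: (('a::{field,finite} ^ 'n) set set set \<times> ('a ^ 'n) set) set)
           \<times> (\<Pi>\<^sub>E X \<in> (Bq (m - 1) :: ('a ^ 'n) set set). DU m X)
         \<approx> (Tq (m - 1) :: (('a ^ 'n) set set set \<times> ('a ^ 'n) set) set)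
           \<times> (\<Pi>\<^sub>E X \<in> (Bq m :: ('a ^ 'n) set set). UD m X)"
proof -
  let ?V = "Bq m :: ('a ^ 'n) set set" and ?W = "Bq (m - 1) :: ('a ^ 'n) set set"
  have m: "m \<le> CARD('n)" using assms(2) by simp
  \<comment> \<open>The pair \<open>A\<^sub>0 \<subseteq> X\<^sub>0\<close> witnesses that both
    vertex sets are nonempty and that the counts \<open>a\<close> and \<open>b\<close> are
    positive.\<close>
  obtain X\<^sub>0 where X\<^sub>0: "X\<^sub>0 \<in> ?V"
    using subspace_between[OF zero_UNIV_in_Bq _ _ m] by auto
  have zero: "{0} \<subseteq> X\<^sub>0" using X\<^sub>0 by (simp add: Bq_def vec.subspace_0)
  obtain A\<^sub>0 where A\<^sub>0: "A\<^sub>0 \<in> ?W" "A\<^sub>0 \<subseteq> X\<^sub>0"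
    using subspace_between[OF zero_UNIV_in_Bq(1) X\<^sub>0 zero, of "m - 1"] by auto
  \<comment> \<open>By transitivity these counts do not depend on the chosen subspaces, so
    \<open>a * b\<close> is the size of every \<open>UD m X\<close> and every \<open>DU m X\<close>
    in the two products.\<close>
  define a where "a = card {A \<in> ?W. A \<subseteq> X\<^sub>0}"
  define b where "b = card {X \<in> ?V. A\<^sub>0 \<subseteq> X}"
  have pos: "a > 0" "b > 0" using A\<^sub>0 X\<^sub>0 by (auto simp: a_def b_def card_gt_0_iff)
  have a: "card {A \<in> ?W. A \<subseteq> X} = a" if "X \<in> ?V" for X
    unfolding a_def by (rule card_subspaces_eq(1)[OF that X\<^sub>0])
  have b: "card {X \<in> ?V. A \<subseteq> X} = b" if "A \<in> ?W" for A
    unfolding b_def by (rule card_subspaces_eq(2)[OF that A\<^sub>0(1)])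
  have edges: "\<exists>u v. e = {u, v}" if "e \<in> grassmann_edges k" for k and e :: "('a ^ 'n) set set"
    using that by (auto simp: grassmann_edges_def)
  have "card (rooted_spanning_trees ?V (grassmann_edges m)) * (a * b) ^ card ?W
      = card (rooted_spanning_trees ?W (grassmann_edges (m - 1))) * (a * b) ^ card ?V"
  proof (rule rooted_spanning_trees_of_biregular_incidence[where I = "(\<subseteq>)"])
    show "?V \<inter> ?W = {}" using assms(1) by (intro Bq_disjoint) simp
    show "?V \<noteq> {}" "?W \<noteq> {}" using X\<^sub>0 A\<^sub>0 by auto
    show "card {X \<in> ?V. A \<subseteq> X \<and> B \<subseteq> X} = (if {A, B} \<in> grassmann_edges (m - 1) then 1 else 0)"
      if "A \<in> ?W" "B \<in> ?W" "A \<noteq> B" for A B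
      using card_common_covers[OF that] assms(1) by simp
    show "card {A \<in> ?W. A \<subseteq> X \<and> A \<subseteq> Y} = (if {X, Y} \<in> grassmann_edges m then 1 else 0)"
      if "X \<in> ?V" "Y \<in> ?V" "X \<noteq> Y" for X Y
      by (rule card_common_hyperplanes[OF assms(1) that])
  qed (use pos a b assms(1) in \<open>simp_all add: grassmann_edges_distinct edges\<close>)
  moreover have "card (\<Pi>\<^sub>E X\<in>?W. DU m X) = (a * b) ^ card ?W"
    using card_DU[OF b a] by (simp add: card_PiE)
  moreover have "card (\<Pi>\<^sub>E X\<in>?V. UD m X) = (a * b) ^ card ?V"
    using card_UD[OF a b] by (simp add: card_PiE)
  ultimately have "card ((Tq m :: (('a ^ 'n) set set set \<times> ('a ^ 'n) set) set) \<times> (\<Pi>\<^sub>E X\<in>?W. DU m X))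
      = card ((Tq (m - 1) :: (('a ^ 'n) set set set \<times> ('a ^ 'n) set) set) \<times> (\<Pi>\<^sub>E X\<in>?V. UD m X))"
    by (simp add: Tq_def card_cartesian_product)
  then show ?thesis
    by (subst eqpoll_iff_card) (auto intro!: finite_cartesian_product finite_PiE)
qed

end
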